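(* Let $\mathcal{C}$ be an $(n,\alpha,\theta,\rho)$-FR code with dual code $\mathcal{C}^t$. Then $N_0(\mathcal{C}^t)=n$, $N_\theta(\mathcal{C}^t)=0$, and for every $k\in\{1,2,\ldots,n\}$ and every $\ell\in\{0,1,\ldots,\theta-1\}$, $$M_k(\mathcal{C})=\theta-\ell \quad\text{whenever}\quad N_{\ell+1}(\mathcal{C}^t)<k\le N_\ell(\mathcal{C}^t).$$ That is, $M_k(\mathcal{C})=\theta$ for $N_1(\mathcal{C}^t)<k\le n=N_0(\mathcal{C}^t)$, $M_k(\mathcal{C})=\theta-1$ for $N_2(\mathcal{C}^t)<k\le N_1(\mathcal{C}^t)$, and so on, down to $M_k(\mathcal{C})=1$ for $N_\theta(\mathcal{C}^t)=0<k\le N_{\theta-1}(\mathcal{C}^t)$.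
   Context: An incidence structure is a triple $(P,\mathcal{B},\mathcal{I})$ with $P$ (points) and $\mathcal{B}$ (blocks) nonempty finite sets and $\mathcal{I}\subseteq P\times\mathcal{B}$; a point $p$ is incident with a block $B$ if $(p,B)\in\mathcal{I}$. Distinct blocks are allowed to be incident with the same set of points. For positive integers $n,\alpha,\theta,\rho$, an $(n,\alpha,\theta,\rho)$-FR (fractional repetition) code is an incidence structure with $|P|=\theta$, $|\mathcal{B}|=n$, every block incident with exactly $\alpha$ points, and every point incident with exactly $\rho$ blocks. The dual of $\mathcal{C}=(P,\mathcal{B},\mathcal{I})$ is $\mathcal{C}^t=(\mathcal{B},P,\mathcal{I}^t)$ with $\mathcal{I}^t=\{(B,p):(p,B)\in\mathcal{I}\}$; it is a $(\theta,\rho,n,\alpha)$-FR code (its points are the blocks of $\mathcal{C}$ and its blocks are the points of $\mathcal{C}$). For an FR code $\mathcal{C}=(P,\mathcal{B},\mathcal{I})$ and $1\le k\le|\mathcal{B}|$, the supported file size is $$M_k(\mathcal{C})=\min_{\mathcal{K}\subseteq\mathcal{B},\,|\mathcal{K}|=k}\bigl|\{p\in P:\exists B\in\mathcal{K},\ (p,B)\in\mathcal{I}\}\bigr|,$$ with $M_0(\mathcal{C})=0$, and $N_k(\mathcal{C})=|P|-M_k(\mathcal{C})$ for $0\le k\le|\mathcal{B}|$. Thus $N_\ell(\mathcal{C}^t)=n-M_\ell(\mathcal{C}^t)$ for $0\le\ell\le\theta$. *)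

theory Defs
  imports Main
begin

text \<open>
  Blocks are abstract objects rather than sets of points, so that distinct blocks may be
  incident with the same set of points.
\<close>

record ('p, 'b) incidence =
  points :: "'p set"
  blocks :: "'b set"
  incid :: "('p \<times> 'b) set"

definition incidence_structure :: "('p, 'b) incidence \<Rightarrow> bool" where
  "incidence_structure C \<longleftrightarrow>
     finite (points C) \<and> points C \<noteq> {} \<and>
     finite (blocks C) \<and> blocks C \<noteq> {} \<and>
     incid C \<subseteq> points C \<times> blocks C"

definition FR_code :: "nat \<Rightarrow> nat \<Rightarrow> nat \<Rightarrow> nat \<Rightarrow> ('p, 'b) incidence \<Rightarrow> bool" where
  "FR_code n \<alpha> \<theta> \<rho> C \<longleftrightarrow>
     0 < n \<and> 0 < \<alpha> \<and> 0 < \<theta> \<and> 0 < \<rho> \<and>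
     incidence_structure C \<and>
     card (points C) = \<theta> \<and>
     card (blocks C) = n \<and>
     (\<forall>B\<in>blocks C. card {p \<in> points C. (p, B) \<in> incid C} = \<alpha>) \<and>
     (\<forall>p\<in>points C. card {B \<in> blocks C. (p, B) \<in> incid C} = \<rho>)"

definition dual :: "('p, 'b) incidence \<Rightarrow> ('b, 'p) incidence" where
  "dual C = \<lparr>points = blocks C, blocks = points C, incid = {(B, p). (p, B) \<in> incid C}\<rparr>"

text \<open>
  The supported file size \<open>M\<^sub>k(C)\<close>, meaningful for \<open>k \<le> card (blocks C)\<close>; for larger
  \<open>k\<close> the minimum is over the empty set and hence unspecified.
\<close>

definition file_size :: "nat \<Rightarrow> ('p, 'b) incidence \<Rightarrow> nat" where
  "file_size k C =
     (if k = 0 then 0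
      else Min ((\<lambda>K. card {p \<in> points C. \<exists>B\<in>K. (p, B) \<in> incid C}) `
                {K. K \<subseteq> blocks C \<and> card K = k}))"

lemma file_size_le_card_points:
  assumes "incidence_structure C" and "k \<le> card (blocks C)"
  shows "file_size k C \<le> card (points C)"
proof (cases "k = 0")
  case False
  let ?f = "\<lambda>K. card {p \<in> points C. \<exists>B\<in>K. (p, B) \<in> incid C}"
  let ?A = "{K. K \<subseteq> blocks C \<and> card K = k}"
  have fin: "finite (points C)" "finite (blocks C)"
    using assms(1) by (auto simp: incidence_structure_def)
  obtain K where "K \<in> ?A"
    using obtain_subset_with_card_n[OF assms(2)] by blast
  moreover have "finite ?A"
    using fin(2) by simp
  ultimately have "Min (?f ` ?A) \<le> ?f K"
    by (intro Min_le) auto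
  also have "?f K \<le> card (points C)"
    using fin(1) by (intro card_mono) auto
  finally show ?thesis
    using False by (simp add: file_size_def)
qed (simp add: file_size_def)

text \<open>
  The number \<open>N\<^sub>k(C) = |P| - M\<^sub>k(C)\<close>. By \<open>file_size_le_card_points\<close> the subtraction
  on natural numbers does not truncate in the range \<open>k \<le> card (blocks C)\<close>.
\<close>

definition file_size_defect :: "nat \<Rightarrow> ('p, 'b) incidence \<Rightarrow> nat" where
  "file_size_defect k C = card (points C) - file_size k C"

end

theory Submission
  imports Defs
begin

text \<open>
  The condition \<open>M\<^sub>k(C) + l \<le> |P|\<close> says that some \<open>k\<close> blocks and some \<open>l\<close> points have no
  incidence between them. This is symmetric under duality, so it is equivalent to
  \<open>M\<^sub>l(C\<^sup>t) + k \<le> |B|\<close>, that is, to \<open>k \<le> N\<^sub>l(C\<^sup>t)\<close>. Hence \<open>N\<^sub>l\<^sub>+\<^sub>1(C\<^sup>t) < k \<le> N\<^sub>l(C\<^sup>t)\<close>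
  pins \<open>M\<^sub>k(C)\<close> down to \<open>|P| - l\<close>.
\<close>

lemma dual_simps [simp]:
  "points (dual C) = blocks C" "blocks (dual C) = points C"
  "(B, p) \<in> incid (dual C) \<longleftrightarrow> (p, B) \<in> incid C"
  by (simp_all add: dual_def)

lemma incidence_structure_dual:
  "incidence_structure C \<Longrightarrow> incidence_structure (dual C)"
  by (auto simp: incidence_structure_def dual_def)

text \<open>A minimising \<open>K\<close> leaves at least \<open>l\<close> points uncovered, and any
  \<open>l\<close> of them serve as \<open>L\<close>; conversely, such an \<open>L\<close> avoids
  the cover of \<open>K\<close> and bounds its size. Writing the bound as a sum avoids truncated
  subtraction and gives a right-hand side symmetric in \<open>K\<close> and
  \<open>L\<close>.\<close>

lemma file_size_add_le_iff:
  assumes C: "incidence_structure C" and k: "k \<le> card (blocks C)" and l: "l \<le> card (points C)"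
  shows "file_size k C + l \<le> card (points C) \<longleftrightarrow>
         (\<exists>K L. K \<subseteq> blocks C \<and> card K = k \<and> L \<subseteq> points C \<and> card L = l \<and>
                (\<forall>p\<in>L. \<forall>B\<in>K. (p, B) \<notin> incid C))"
    (is "_ \<longleftrightarrow> ?R")
proof -
  let ?cov = "\<lambda>K. {p \<in> points C. \<exists>B\<in>K. (p, B) \<in> incid C}"
  let ?A = "{K. K \<subseteq> blocks C \<and> card K = k}"
  have fin: "finite (points C)" "finite (blocks C)"
    using C by (auto simp: incidence_structure_def)
  have A: "finite ?A" "?A \<noteq> {}"
    using fin(2) obtain_subset_with_card_n[OF k] by auto
  \<comment> \<open>The separate clause of \<open>file_size\<close> for \<open>k = 0\<close> agrees
    with the minimum, since the only candidate \<open>{}\<close> covers no point. The rest thus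
    needs no case split on \<open>k\<close>.\<close>
  have "?A = {{}}" if "k = 0"
    using that fin(2) by (auto simp: card_eq_0_iff dest: finite_subset)
  then have size: "file_size k C = Min ((\<lambda>K. card (?cov K)) ` ?A)"
    by (auto simp: file_size_def)
  have "file_size k C + l \<le> card (points C) \<longleftrightarrow> file_size k C \<le> card (points C) - l"
    using l by auto
  also have "\<dots> \<longleftrightarrow> (\<exists>K\<in>?A. card (?cov K) \<le> card (points C) - l)"
    unfolding size using A by (subst Min_le_iff) auto
  also have "\<dots> \<longleftrightarrow> (\<exists>K\<in>?A. l \<le> card (points C - ?cov K))"
  proof (intro bex_cong refl)
    fix K
    have "card (points C - ?cov K) = card (points C) - card (?cov K)"
      using fin(1) by (intro card_Diff_subset) auto
    moreover have "card (?cov K) \<le> card (points C)"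
      using fin(1) by (intro card_mono) auto
    ultimately show "card (?cov K) \<le> card (points C) - l \<longleftrightarrow> l \<le> card (points C - ?cov K)"
      using l by linarith
  qed
  \<comment> \<open>A finite set has at least \<open>l\<close> elements iff it has a subset of size
    exactly \<open>l\<close>.\<close>
  also have "\<dots> \<longleftrightarrow> (\<exists>K\<in>?A. \<exists>L. L \<subseteq> points C - ?cov K \<and> card L = l)"
  proof (intro bex_cong refl)
    fix K
    show "l \<le> card (points C - ?cov K) \<longleftrightarrow> (\<exists>L. L \<subseteq> points C - ?cov K \<and> card L = l)"
      using fin(1) card_mono[of "points C - ?cov K"] obtain_subset_with_card_n[of l "points C - ?cov K"]
      by blast
  qed
  also have "\<dots> \<longleftrightarrow> ?R"
  proof -
    have "L \<subseteq> points C - ?cov K \<longleftrightarrow> L \<subseteq> points C \<and> (\<forall>p\<in>L. \<forall>B\<in>K. (p, B) \<notin> incid C)" for K L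
      by blast
    then show ?thesis by auto
  qed
  finally show ?thesis .
qed

lemma file_size_dual_add_le_iff:
  assumes "incidence_structure C" "k \<le> card (blocks C)" "l \<le> card (points C)"
  shows "file_size l (dual C) + k \<le> card (blocks C) \<longleftrightarrow> file_size k C + l \<le> card (points C)"
proof -
  have "file_size l (dual C) + k \<le> card (blocks C) \<longleftrightarrow>
        (\<exists>L K. L \<subseteq> points C \<and> card L = l \<and> K \<subseteq> blocks C \<and> card K = k \<and>
               (\<forall>B\<in>K. \<forall>p\<in>L. (p, B) \<notin> incid C))"
    using file_size_add_le_iff[OF incidence_structure_dual[OF assms(1)], of l k] assms(2,3)
    by simp
  also have "\<dots> \<longleftrightarrow> file_size k C + l \<le> card (points C)"
    unfolding file_size_add_le_iff[OF assms] by blast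
  finally show ?thesis .
qed

text \<open>Since M_l of the dual is at most the number of blocks, the subtraction in
  \<open>file_size_defect\<close> does not truncate, so \<open>k\<close> can be moved across the
  inequality, even for \<open>k = 0\<close>.\<close>

lemma le_file_size_defect_dual_iff:
  assumes "incidence_structure C" "k \<le> card (blocks C)" "l \<le> card (points C)"
  shows "k \<le> file_size_defect l (dual C) \<longleftrightarrow> file_size k C + l \<le> card (points C)"
  using file_size_dual_add_le_iff[OF assms] assms(3)
    file_size_le_card_points[OF incidence_structure_dual[OF assms(1)], of l]
  by (auto simp: file_size_defect_def)

theorem theorem4:
  fixes C :: "('p, 'b) incidence" and n \<alpha> \<theta> \<rho> :: nat
  assumes "FR_code n \<alpha> \<theta> \<rho> C"
  shows "file_size_defect 0 (dual C) = n \<and>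
         file_size_defect \<theta> (dual C) = 0 \<and>
         (\<forall>k\<in>{1..n}. \<forall>l\<in>{0..<\<theta>}.
            file_size_defect (l + 1) (dual C) < k \<and> k \<le> file_size_defect l (dual C) \<longrightarrow>
            file_size k C = \<theta> - l)"
proof (intro conjI ballI impI)
  have C: "incidence_structure C" "card (points C) = \<theta>" "card (blocks C) = n" "0 < n" "0 < \<alpha>"
    and block: "\<And>B. B \<in> blocks C \<Longrightarrow> card {p \<in> points C. (p, B) \<in> incid C} = \<alpha>"
    using assms by (auto simp: FR_code_def)
  have fin: "finite (points C)"
    using C(1) by (simp add: incidence_structure_def)
  show "file_size_defect 0 (dual C) = n"
    using C(3) by (simp add: file_size_defect_def file_size_def)
  show "file_size_defect \<theta> (dual C) = 0"
  proof (rule ccontr)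
    assume "file_size_defect \<theta> (dual C) \<noteq> 0"
    \<comment> \<open>A nonzero defect is at least 1, so the equivalence applies with
      \<open>k = 1\<close>: some single block misses \<theta> points.\<close>
    then have "file_size 1 C + \<theta> \<le> card (points C)"
      using le_file_size_defect_dual_iff[OF C(1), of 1 \<theta>] C by simp
    then obtain K L where KL: "K \<subseteq> blocks C" "card K = 1" "L \<subseteq> points C" "card L = \<theta>"
      "\<forall>p\<in>L. \<forall>B\<in>K. (p, B) \<notin> incid C"
      using file_size_add_le_iff[OF C(1), of 1 \<theta>] C by auto
    \<comment> \<open>Being of full size, \<open>L\<close> contains every point, so the block in
      \<open>K\<close> is incident with none, against \<open>0 < \<alpha>\<close>.\<close>
    have "L = points C"
      using KL(3,4) C(2) fin by (simp add: card_subset_eq)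
    moreover obtain B where "B \<in> K"
      using KL(2) by (auto simp: card_1_singleton_iff)
    ultimately have "{p \<in> points C. (p, B) \<in> incid C} = {}" "B \<in> blocks C"
      using KL(1,5) by auto
    then show False
      using block[of B] C(5) by (metis card.empty less_irrefl)
  qed
  fix k l
  assume "k \<in> {1..n}" "l \<in> {0..<\<theta>}"
    and "file_size_defect (l + 1) (dual C) < k \<and> k \<le> file_size_defect l (dual C)"
  \<comment> \<open>The upper bound on \<open>k\<close> gives M_k + l \<le> \<theta>. The strict
    lower bound negates the equivalence at \<open>l + 1\<close>, which is admissible because
    \<open>l < \<theta>\<close>, and gives \<theta> < M_k + l + 1. Together they force M_k + l =
    \<theta>.\<close>
  then show "file_size k C = \<theta> - l"
    using le_file_size_defect_dual_iff[OF C(1), of k l]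
      le_file_size_defect_dual_iff[OF C(1), of k "l + 1"] C(2,3)
    by auto
qed

end
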